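(* Let $X$ be an Archimedean vector lattice. A subspace of $X$ of codimension one is full if and only if it is the kernel of a positive linear functional on $X$.
   Context: Vector lattices are over $\mathbb R$. A linear subspace $Y$ of $X$ is full if $x,y\in Y$ and $x\le y$ imply $[x,y]\subseteq Y$, where $[x,y]=\{z\in X : x\le z\le y\}$. A subspace $F$ of $X$ has codimension $n$ if $\dim X/F=n$. *)

theory Defs
  imports Complex_Main
begin

class vector_lattice = ordered_real_vector + lattice

class archimedean_vector_lattice = vector_lattice +
  assumes archimedean:
    "0 \<le> x \<Longrightarrow> (\<And>n::nat. real n *\<^sub>R x \<le> y) \<Longrightarrow> x = 0"

definition full_subspace :: "'a::vector_lattice set \<Rightarrow> bool" where
  "full_subspace Y \<longleftrightarrow>
     subspace Y \<and> (\<forall>x\<in>Y. \<forall>y\<in>Y. x \<le> y \<longrightarrow> {x..y} \<subseteq> Y)"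

definition coset :: "'a::real_vector set \<Rightarrow> 'a \<Rightarrow> 'a set" where
  "coset F x = (+) x ` F"

definition quotient_space :: "'a::real_vector set \<Rightarrow> 'a set set" where
  "quotient_space F = range (coset F)"

text \<open>
  The dimension of the quotient of the whole space by \<open>F\<close> is \<open>n\<close> if the quotient has a basis
  consisting of \<open>n\<close> cosets \<open>coset F (b i)\<close>, \<open>i < n\<close>. The linear combination of these cosets
  with coefficients \<open>c i\<close> is the coset of \<open>\<Sum>i<n. c i *\<^sub>R b i\<close>, and the zero of the
  quotient is \<open>coset F 0 = F\<close>.
\<close>

definition quotient_basis :: "'a::real_vector set \<Rightarrow> nat \<Rightarrow> (nat \<Rightarrow> 'a) \<Rightarrow> bool" where
  "quotient_basis F n b \<longleftrightarrow>
     (\<forall>A\<in>quotient_space F. \<exists>c::nat \<Rightarrow> real. A = coset F (\<Sum>i<n. c i *\<^sub>R b i)) \<and>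
     (\<forall>c::nat \<Rightarrow> real. coset F (\<Sum>i<n. c i *\<^sub>R b i) = coset F 0 \<longrightarrow> (\<forall>i<n. c i = 0))"

definition has_codimension :: "'a::real_vector set \<Rightarrow> nat \<Rightarrow> bool" where
  "has_codimension F n \<longleftrightarrow> subspace F \<and> (\<exists>b. quotient_basis F n b)"

definition positive_functional :: "('a::vector_lattice \<Rightarrow> real) \<Rightarrow> bool" where
  "positive_functional f \<longleftrightarrow> linear f \<and> (\<forall>x\<ge>0. 0 \<le> f x)"

end

theory Submission
  imports Defs
begin

text \<open>
  A subspace of codimension one is the kernel of a linear functional \<open>f\<close>, namely the coordinate
  with respect to a basis of the quotient. It is full if and only if \<open>f\<close> or \<open>- f\<close> is positive.
  Indeed, if there are \<open>u, v \<ge> 0\<close> with \<open>f u > 0 > f v\<close>, then some \<open>w = u + t v\<close> with \<open>t > 0\<close> lies in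
  the kernel, and \<open>0 \<le> u \<le> w\<close>, so fullness puts \<open>u\<close> in the kernel, contradicting \<open>f u > 0\<close>.
  The converse is monotonicity of positive functionals.
\<close>

lemma coset_eq_coset_iff:
  assumes "subspace F"
  shows "coset F x = coset F y \<longleftrightarrow> x - y \<in> F"
proof
  assume "coset F x = coset F y"
  moreover have "x \<in> coset F x"
    using subspace_0[OF assms] by (force simp: coset_def)
  ultimately show "x - y \<in> F"
    by (auto simp: coset_def)
next
  have sub: "coset F u \<subseteq> coset F v" if "u - v \<in> F" for u v
  proof
    fix z assume "z \<in> coset F u"
    then obtain a where a: "a \<in> F" "z = u + a"
      by (auto simp: coset_def)
    have "(u - v) + a \<in> F"
      using subspace_add[OF assms that a(1)] .
    moreover have "z = v + ((u - v) + a)"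
      using a(2) by simp
    ultimately show "z \<in> coset F v"
      unfolding coset_def by blast
  qed
  assume xy: "x - y \<in> F"
  then have "y - x \<in> F"
    using subspace_neg[OF assms xy] by simp
  with xy sub show "coset F x = coset F y"
    by blast
qed

lemma codimension_one_is_kernel:
  fixes F :: "'a::real_vector set"
  assumes "has_codimension F 1"
  obtains f :: "'a \<Rightarrow> real" where "linear f" "F = {x. f x = 0}"
proof -
  have F: "subspace F"
    using assms by (simp add: has_codimension_def)
  obtain b where basis: "quotient_basis F 1 b"
    using assms by (auto simp: has_codimension_def)
  define e where "e = b 0"
  have ex: "\<exists>c. x - c *\<^sub>R e \<in> F" for x
  proof -
    have "coset F x \<in> quotient_space F"
      by (simp add: quotient_space_def)
    then obtain c :: "nat \<Rightarrow> real" where "coset F x = coset F (\<Sum>i<1. c i *\<^sub>R b i)"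
      using basis unfolding quotient_basis_def by blast
    then show ?thesis
      using coset_eq_coset_iff[OF F] by (auto simp: e_def)
  qed
  have zero: "c = 0" if "c *\<^sub>R e \<in> F" for c
  proof -
    have "coset F (\<Sum>i<1. c *\<^sub>R b i) = coset F 0"
      using that coset_eq_coset_iff[OF F] by (simp add: e_def)
    moreover have "coset F (\<Sum>i<1. c *\<^sub>R b i) = coset F 0 \<longrightarrow> (\<forall>i<1::nat. c = 0)"
      using basis unfolding quotient_basis_def by (elim conjE) (erule spec[of _ "\<lambda>_. c"])
    ultimately show ?thesis by simp
  qed
  \<comment> \<open>The coordinate of the coset of \<open>x\<close> with respect to the basis vector \<open>e + F\<close>.\<close>
  define f where "f x = (SOME c. x - c *\<^sub>R e \<in> F)" for x
  have f: "x - f x *\<^sub>R e \<in> F" for x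
    unfolding f_def using ex by (rule someI_ex)
  have f_eq: "f x = c" if "x - c *\<^sub>R e \<in> F" for x c
  proof -
    have "(x - c *\<^sub>R e) - (x - f x *\<^sub>R e) \<in> F"
      using subspace_diff[OF F that f] .
    then have "(f x - c) *\<^sub>R e \<in> F"
      by (simp add: algebra_simps)
    then show ?thesis using zero[of "f x - c"] by simp
  qed
  have "linear f"
  proof (rule linearI)
    fix x y
    have "(x - f x *\<^sub>R e) + (y - f y *\<^sub>R e) \<in> F"
      by (intro subspace_add F f)
    then show "f (x + y) = f x + f y"
      by (intro f_eq) (simp add: algebra_simps)
  next
    fix r x
    have "r *\<^sub>R (x - f x *\<^sub>R e) \<in> F"
      by (intro subspace_scale F f)
    then show "f (r *\<^sub>R x) = r *\<^sub>R f x"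
      by (intro f_eq) (simp add: algebra_simps)
  qed
  moreover have "F = {x. f x = 0}"
  proof (intro set_eqI iffI)
    fix x assume "x \<in> F"
    then show "x \<in> {x. f x = 0}"
      using f_eq[of x 0] by simp
  next
    fix x assume "x \<in> {x. f x = 0}"
    then show "x \<in> F"
      using f[of x] by simp
  qed
  ultimately show thesis by (rule that)
qed

lemma full_kernel_imp_positive_or_negative:
  fixes f :: "'a::vector_lattice \<Rightarrow> real"
  assumes "linear f" and full: "full_subspace {x. f x = 0}"
  shows "positive_functional f \<or> positive_functional (\<lambda>x. - f x)"
proof (rule ccontr)
  interpret linear f by fact
  assume "\<not> ?thesis"
  then obtain u v where u: "0 \<le> u" "f u > 0" and v: "0 \<le> v" "f v < 0"
    using \<open>linear f\<close> linear_compose_neg[OF \<open>linear f\<close>]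
    by (auto simp: positive_functional_def not_le)
  \<comment> \<open>The coefficient of \<open>v\<close> is the positive number that makes \<open>f w\<close> vanish.\<close>
  define w where "w = u + (- f u / f v) *\<^sub>R v"
  have "f w = 0"
    using v(2) by (simp add: w_def add scale neg diff)
  moreover have "0 \<le> (- f u / f v) *\<^sub>R v"
    using u v by (intro scaleR_nonneg_nonneg) (simp_all add: divide_nonneg_neg divide_nonpos_neg)
  then have "u \<le> w"
    by (simp add: w_def)
  moreover have "\<forall>x\<in>{x. f x = 0}. \<forall>y\<in>{x. f x = 0}. x \<le> y \<longrightarrow> {x..y} \<subseteq> {x. f x = 0}"
    using full by (simp add: full_subspace_def)
  moreover have "0 \<le> w"
    using u(1) \<open>u \<le> w\<close> by (rule order_trans)
  ultimately have "{0..w} \<subseteq> {x. f x = 0}"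
    using zero by simp
  then have "u \<in> {x. f x = 0}"
    using u(1) \<open>u \<le> w\<close> by (auto simp: subset_iff)
  with u(2) show False by simp
qed

lemma full_kernel_of_positive:
  assumes "positive_functional f"
  shows "full_subspace {x. f x = 0}"
proof -
  have lin: "linear f" and pos: "\<And>x. 0 \<le> x \<Longrightarrow> 0 \<le> f x"
    using assms by (auto simp: positive_functional_def)
  have mono: "f x \<le> f y" if "x \<le> y" for x y
    using pos[of "y - x"] that by (simp add: linear_diff[OF lin])
  show ?thesis
    unfolding full_subspace_def
  proof (intro conjI ballI impI subsetI)
    show "subspace {x. f x = 0}"
      using lin by (rule linear_subspace_kernel)
  next
    fix x y z assume "x \<in> {x. f x = 0}" "y \<in> {x. f x = 0}" "z \<in> {x..y}"
    then show "z \<in> {x. f x = 0}"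
      using mono[of x z] mono[of z y] by simp
  qed
qed

theorem proposition4p10:
  fixes F :: "'a::archimedean_vector_lattice set"
  assumes "subspace F"
    and "has_codimension F 1"
  shows "full_subspace F \<longleftrightarrow> (\<exists>f. positive_functional f \<and> F = {x. f x = 0})"
proof
  assume full: "full_subspace F"
  obtain f :: "'a \<Rightarrow> real" where f: "linear f" "F = {x. f x = 0}"
    using codimension_one_is_kernel[OF assms(2)] by blast
  have "positive_functional f \<or> positive_functional (\<lambda>x. - f x)"
    using full_kernel_imp_positive_or_negative[OF f(1)] full f(2) by simp
  moreover have "F = {x. - f x = 0}"
    using f(2) by simp
  ultimately show "\<exists>f. positive_functional f \<and> F = {x. f x = 0}"
    using f(2) by blast
next
  assume "\<exists>f. positive_functional f \<and> F = {x. f x = 0}"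
  then show "full_subspace F"
    using full_kernel_of_positive by blast
qed

end
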